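(* Let $D\ge 1$ be an integer, let $b_1,\dots,b_D\in\mathbb R$, and let $$\Phi(x)=b_1B_1(x)+b_2\frac{B_2(x)}{2}+\cdots+b_D\frac{B_D(x)}{D}.$$ If $\Phi(0)=\Phi\left(\frac1D\right)=\cdots=\Phi\left(\frac{D-1}{D}\right)=0$, then $\Phi=0$.
   Context: The Bernoulli polynomials $B_n(x)$ are defined by $\frac{ze^{xz}}{e^z-1}=\sum_{n\ge 0}B_n(x)\frac{z^n}{n!}$. *)

theory Defs
  imports Complex_Main "HOL-Computational_Algebra.Formal_Power_Series"
begin

text \<open>
  The generating function \<open>z e\<^sup>x\<^sup>z / (e\<^sup>z - 1)\<close> is read as a formal power series in \<open>z\<close>, for a
  fixed real \<open>x\<close>.  The denominator has no constant term, so it is not a unit; the division is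
  exact because the numerator is divisible by \<open>z\<close>, as \<open>bernoulli_poly_gf\<close> confirms.
\<close>

definition bernoulli_poly :: "nat \<Rightarrow> real \<Rightarrow> real" where
  "bernoulli_poly n x = fact n * fps_nth (fps_X * fps_exp x / (fps_exp 1 - 1)) n"

lemma bernoulli_poly_gf:
  "Abs_fps (\<lambda>n. bernoulli_poly n x / fact n) * (fps_exp 1 - 1) = fps_X * fps_exp x"
proof -
  have nz: "fps_nth (fps_exp 1 - 1 :: real fps) 1 \<noteq> 0" by simp
  hence ne: "fps_exp 1 - 1 \<noteq> (0 :: real fps)" by (metis fps_zero_nth)
  have "subdegree (fps_exp 1 - 1 :: real fps) \<le> 1"
    using nz by (rule subdegree_leI)
  moreover have "subdegree (fps_X * fps_exp x :: real fps) \<ge> 1"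
    by (subst subdegree_mult) auto
  ultimately have "(fps_exp 1 - 1 :: real fps) dvd fps_X * fps_exp x"
    using ne by (simp add: fps_dvd_iff)
  moreover have "Abs_fps (\<lambda>n. bernoulli_poly n x / fact n) = fps_X * fps_exp x / (fps_exp 1 - 1)"
    by (simp add: fps_eq_iff bernoulli_poly_def)
  ultimately show ?thesis by simp
qed

end

theory Submission
  imports Defs "HOL-Computational_Algebra.Polynomial"
begin

text \<open>
  \<open>\<Phi>\<close> is a polynomial of degree at most \<open>D\<close> with \<open>D\<close> prescribed roots, so it is a constant \<open>c\<close> times
  \<open>\<Prod>j<D. (x - j / D)\<close>.  Since the antiderivative \<open>B\<^sub>n\<^sub>+\<^sub>1 / (n + 1)\<close> of \<open>B\<^sub>n\<close> takes the same value at \<open>0\<close>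
  and \<open>1\<close> for \<open>n \<ge> 1\<close>, Rolle's theorem yields \<open>s \<in> (0, 1)\<close> with \<open>\<Sum>k<D. \<Phi> ((s + k) / D) = 0\<close>.
  Up to the factor \<open>c\<close> and a positive constant, this sum is \<open>\<Sum>k<D. (s + k gchoose D)\<close>, which telescopes
  to \<open>(s + D gchoose D + 1) - (s gchoose D + 1) > 0\<close>; hence \<open>c = 0\<close>.
\<close>

text \<open>A \<open>real poly\<close>, so that degree and \<open>pderiv\<close> are available. The
  coefficient of \<open>x^i\<close> is the classical \<open>(n choose i)\<close> times the Bernoulli
  number of index \<open>n - i\<close>.\<close>

definition bernoulli_pol :: "nat \<Rightarrow> real poly" where
  "bernoulli_pol n =
    (\<Sum>i\<le>n. monom (fact n * fps_nth (fps_X / (fps_exp 1 - 1)) (n - i) / fact i) i)"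

lemma coeff_bernoulli_pol:
  "coeff (bernoulli_pol n) i =
    (if i \<le> n then fact n * fps_nth (fps_X / (fps_exp 1 - 1)) (n - i) / fact i else 0)"
  by (simp add: bernoulli_pol_def coeff_sum)

lemma degree_bernoulli_pol: "degree (bernoulli_pol n) \<le> n"
  by (rule degree_le) (simp add: coeff_bernoulli_pol)

lemma pderiv_bernoulli_pol:
  "pderiv (bernoulli_pol (Suc n)) = smult (real (Suc n)) (bernoulli_pol n)"
  by (rule poly_eqI)
    (auto simp: coeff_pderiv coeff_bernoulli_pol field_simps simp del: of_nat_Suc)

lemma subdegree_fps_exp_minus_1: "subdegree (fps_exp 1 - 1 :: real fps) = 1"
  by (rule subdegreeI) auto

lemma fps_exp_minus_1_nonzero: "fps_exp 1 - 1 \<noteq> (0 :: real fps)"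
  using subdegree_fps_exp_minus_1 by (metis subdegree_0 zero_neq_one)

lemma bernoulli_poly_eq_poly: "bernoulli_poly n x = poly (bernoulli_pol n) x"
proof -
  have "fps_X * fps_exp x / (fps_exp 1 - 1) = fps_exp x * (fps_X / (fps_exp 1 - 1))"
    by (subst fps_divide_times2) (simp_all only: subdegree_fps_exp_minus_1 subdegree_fps_X mult.commute)
  then have "bernoulli_poly n x =
      (\<Sum>i\<le>n. fact n * (x ^ i / fact i * fps_nth (fps_X / (fps_exp 1 - 1)) (n - i)))"
    by (simp add: bernoulli_poly_def fps_mult_nth sum_distrib_left atLeast0AtMost)
  then show ?thesis
    by (simp add: bernoulli_pol_def poly_sum poly_monom field_simps)
qed

text \<open>The generating functions at 1 and 0 differ by
  \<open>(z e^z - z) / (e^z - 1) = z\<close>, which affects only the coefficient of index 1.\<close>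

lemma bernoulli_poly_1:
  assumes "n \<noteq> 1"
  shows "bernoulli_poly n 1 = bernoulli_poly n 0"
proof -
  let ?E = "fps_exp 1 - 1 :: real fps"
  have "Abs_fps (\<lambda>n. bernoulli_poly n 1 / fact n) * ?E
      = (Abs_fps (\<lambda>n. bernoulli_poly n 0 / fact n) + fps_X) * ?E"
    unfolding distrib_right bernoulli_poly_gf by (simp add: algebra_simps)
  then have "Abs_fps (\<lambda>n. bernoulli_poly n 1 / fact n)
      = Abs_fps (\<lambda>n. bernoulli_poly n 0 / fact n) + fps_X"
    using fps_exp_minus_1_nonzero by simp
  then have "bernoulli_poly n 1 / fact n = bernoulli_poly n 0 / fact n + fps_nth fps_X n"
    by (metis fps_add_nth fps_nth_Abs_fps)
  then show ?thesis
    using assms by simp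
qed

lemma sum_shifted_gbinomial:
  fixes a :: "'a :: field_char_0"
  shows "(\<Sum>k<n. (a + of_nat k) gchoose m) = ((a + of_nat n) gchoose Suc m) - (a gchoose Suc m)"
proof (induction n)
  case (Suc n)
  then show ?case
    using gbinomial_Suc_Suc[of "a + of_nat n" m] by (simp add: add_ac)
qed simp

lemma gbinomial_less_shifted:
  fixes s :: real
  assumes "0 < s" "n \<ge> 1"
  shows "(s gchoose Suc n) < ((s + real n) gchoose Suc n)"
proof -
  have "(\<Prod>i<Suc n. s - real i) \<le> (\<Prod>i<Suc n. \<bar>s - real i\<bar>)"
    by (metis abs_ge_self abs_prod)
  \<comment> \<open>Strictness comes from the index 1, in range since \<open>n \<ge> 1\<close>; at
    index 0 both factors equal \<open>s\<close>.\<close>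
  also have "\<dots> < (\<Prod>i<Suc n. s + real i)"
    using assms by (intro prod_mono_strict[of 1]) auto
  also have "\<dots> = (\<Prod>i<Suc n. s + real (n - i))"
    using prod.nat_diff_reindex[of "\<lambda>i. s + real i" "Suc n"] by simp
  also have "\<dots> = (\<Prod>i<Suc n. s + real n - real i)"
    by (intro prod.cong) (auto simp: of_nat_diff)
  finally show ?thesis
    by (simp add: gbinomial_prod_rev atLeast0LessThan divide_strict_right_mono del: prod.lessThan_Suc)
qed

text \<open>The difference of the two sides has degree below \<open>card A\<close> or is zero, yet
  vanishes on all of \<open>A\<close>.\<close>

lemma poly_eq_smult_prod_roots:
  fixes p :: "'a :: idom poly"
  assumes "finite A" "degree p \<le> card A" "\<And>x. x \<in> A \<Longrightarrow> poly p x = 0"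
  shows "p = smult (coeff p (card A)) (\<Prod>a\<in>A. [:-a, 1:])"
proof -
  let ?q = "\<Prod>a\<in>A. [:-a, 1:]"
  have deg: "degree ?q = card A"
    by (subst degree_prod_eq_sum_degree) auto
  moreover have "lead_coeff ?q = 1"
    by (simp add: lead_coeff_prod)
  ultimately have "coeff ?q (card A) = 1"
    by simp
  moreover have "poly ?q x = 0" if "x \<in> A" for x
    using assms(1) that by (auto simp: poly_prod)
  ultimately show ?thesis
    using assms deg
    by (intro poly_eqI_degree_lead_coeff[where n = "card A" and A = A])
      (auto intro: order.trans[OF degree_smult_le])
qed

text \<open>The conditions on \<open>P\<close> say that \<open>p\<close> has integral 0 over
  \<open>[0, 1]\<close>; this is all that is used of the Bernoulli polynomials.\<close>

lemma poly_mean_zero_equispaced_roots: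
  fixes p P :: "real poly"
  assumes "D \<ge> 1" "degree p \<le> D" "\<And>j. j < D \<Longrightarrow> poly p (real j / real D) = 0"
    and "pderiv P = p" "poly P 1 = poly P 0"
  shows "p = 0"
proof -
  let ?A = "(\<lambda>j. real j / real D) ` {..<D}"
  define c where "c = coeff p D"
  have inj: "inj_on (\<lambda>j. real j / real D) {..<D}"
    using assms(1) by (auto simp: inj_on_def)
  then have "card ?A = D"
    by (simp add: card_image)
  then have p: "p = smult c (\<Prod>a\<in>?A. [:-a, 1:])"
    using poly_eq_smult_prod_roots[of ?A p] assms(2,3) by (auto simp: c_def)
  have poly_p: "poly p (x / real D) = c * fact D / real D ^ D * (x gchoose D)" for x
  proof -
    have "poly p (x / real D) = c * (\<Prod>j<D. (x - real j) / real D)"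
      by (subst p) (simp add: poly_prod prod.reindex[OF inj] diff_divide_distrib)
    then show ?thesis
      by (simp add: prod_dividef gbinomial_prod_rev atLeast0LessThan)
  qed
  \<comment> \<open>Folding the \<open>D\<close> subintervals of \<open>[0, 1]\<close> onto one
    makes the mean value theorem give a single \<open>s\<close> for all \<open>k\<close>.\<close>
  define W where "W = (\<lambda>s. \<Sum>k<D. poly P ((s + real k) / real D))"
  have "(W has_real_derivative (\<Sum>k<D. poly p ((s + real k) / real D) / real D)) (at s)" for s
    unfolding W_def using assms(1,4)
    by (auto intro!: derivative_eq_intros sum.cong)
  then obtain s where s: "0 < s" "s < 1"
    and "W 1 - W 0 = (\<Sum>k<D. poly p ((s + real k) / real D) / real D)"
    using MVT2[of 0 1 W "\<lambda>s. \<Sum>k<D. poly p ((s + real k) / real D) / real D"] by auto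
  \<comment> \<open>Raising \<open>s\<close> from 0 to 1 replaces \<open>k\<close> by
    \<open>k + 1\<close>, so only the end terms survive.\<close>
  moreover have "W 1 - W 0 = poly P 1 - poly P 0"
    using sum_lessThan_telescope[of "\<lambda>k. poly P (real k / real D)" D] assms(1)
    by (simp add: W_def sum_subtractf add_ac)
  ultimately have "(\<Sum>k<D. poly p ((s + real k) / real D) / real D) = 0"
    using assms(5) by simp
  then have "c * fact D / real D ^ D / real D * (\<Sum>k<D. (s + real k) gchoose D) = 0"
    unfolding poly_p sum_distrib_left by (simp only: times_divide_eq_left)
  moreover have "(\<Sum>k<D. (s + real k) gchoose D) > 0"
    using gbinomial_less_shifted[OF s(1) assms(1)] sum_shifted_gbinomial[of s D D] by simp
  ultimately have "c = 0"
    using assms(1) by auto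
  then show ?thesis
    using p by simp
qed

theorem proposition2p6:
  fixes D :: nat and b :: "nat \<Rightarrow> real" and \<Phi> :: "real \<Rightarrow> real"
  assumes "D \<ge> 1"
    and "\<Phi> = (\<lambda>x. \<Sum>n=1..D. b n * (bernoulli_poly n x / real n))"
    and "\<forall>j<D. \<Phi> (real j / real D) = 0"
  shows "\<Phi> = (\<lambda>x. 0)"
proof -
  define p where "p = (\<Sum>n=1..D. smult (b n / real n) (bernoulli_pol n))"
  \<comment> \<open>Since \<open>n\<close> starts at 1, only indices \<open>Suc n \<ge> 2\<close>
    occur, which avoids the exception in \<open>bernoulli_poly_1\<close>.\<close>
  define P where
    "P = (\<Sum>n=1..D. smult (b n / real n / real (Suc n)) (bernoulli_pol (Suc n)))"
  have \<Phi>: "\<Phi> = poly p"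
    by (auto simp: assms(2) p_def poly_sum bernoulli_poly_eq_poly)
  have "degree p \<le> D"
    unfolding p_def
    by (intro degree_sum_le) (auto intro!: order.trans[OF degree_smult_le]
        order.trans[OF degree_bernoulli_pol])
  moreover have "pderiv P = p"
    by (simp add: P_def p_def higher_pderiv_sum[of 1, simplified] pderiv_smult pderiv_bernoulli_pol del: of_nat_Suc)
  moreover have "poly P 1 = poly P 0"
    by (auto simp: P_def poly_sum bernoulli_poly_1 simp flip: bernoulli_poly_eq_poly intro!: sum.cong)
  ultimately have "p = 0"
    using assms(1,3) \<Phi> by (intro poly_mean_zero_equispaced_roots[of D p P]) auto
  then show ?thesis
    by (auto simp: \<Phi>)
qed

end
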